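(* Let $\nu:\mathbb F_q[x]\to\mathbb C$ be multiplicative with $|\nu|\le1$, let $f:\mathbb F_q[x]\to\mathbb C$ satisfy $|f|\le1$, and let $\phi:\mathbb N\to\mathbb R_{\ge0}$ with $\phi(n)\to\infty$. For $k\in\mathbb N$ let $P_k=\{g\in\mathbb F_q[x]: g\text{ irreducible},\ k\le\deg g\le k+1\}$. Assume that for each $n$ and each integer $k\in[\phi(n),\phi(n)+\phi(n)^2]$, \[\sum_{a,b\in P_k}\Big|\sum_{g\in G_{\min\{n-\deg a,\,n-\deg b\}}}f(ag)\overline{f(bg)}\Big|=o(|P_k|^2q^{n-k})\] as $n\to\infty$ (uniformly in such $k$). Then $\sum_{g\in G_n}\nu(g)f(g)=o(q^n)$.
   Context: $G_m$ denotes the set of polynomials in $\mathbb F_q[x]$ of degree at most $m-1$. A function $\nu$ is multiplicative if $\nu(gh)=\nu(g)\nu(h)$ for all coprime $g,h$.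
   Formalization: The formal theorem adds the assumption φ(n)=o(n); without it the claim fails, e.g. φ(n)=2n, ν=1, f(0)=0 and f(g)=1 for g≠0, where the correlation condition holds because the inner sums vanish, but the sum over G_n is q^n−1. *)

theory Defs
  imports
    Complex_Main
    "HOL-Library.Cardinality"
    "HOL-Library.Landau_Symbols"
    "HOL-Computational_Algebra.Polynomial"
begin

text \<open>
  \<open>\<bbbF>\<^sub>q\<close> is a type \<open>'a :: {field, finite}\<close> with \<open>q = CARD('a)\<close>.
\<close>

text \<open>
  The zero polynomial has degree \<open>-\<infinity>\<close> on paper but \<open>0\<close> in the library, so it is added
  explicitly. The index is an integer: it is used at \<open>min (n - deg a) (n - deg b)\<close>, which is
  negative when \<open>k\<close> exceeds \<open>n\<close>, and then the set is \<open>{0}\<close>.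

  This matters for the growth of \<open>\<phi>\<close>. If \<open>f 0 = 0\<close>, the correlation condition says nothing
  about \<open>k \<ge> n\<close>, so that for \<open>\<phi>(n) = 2n\<close> it holds with \<open>f = 1\<close> off \<open>0\<close> although the
  conclusion fails for \<open>\<nu> = 1\<close>. The same happens for \<open>\<phi>(n) = c n\<close> with \<open>0 < c < 1\<close>, taking
  \<open>f\<close> to be the indicator of the nonzero \<open>g\<close> whose irreducible factors all have degree less
  than \<open>c deg g\<close>. Hence the hypothesis \<open>\<phi>(n) = o(n)\<close> of the theorem. It holds whenever the
  window \<open>[\<phi>(n), \<phi>(n) + \<phi>(n)\<^sup>2]\<close> stays below \<open>n\<close> for large \<open>n\<close>, which is what the index set
  presupposes and what the correlation condition itself forces if \<open>f 0 \<noteq> 0\<close>.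
\<close>

definition polys_below :: "int \<Rightarrow> 'a::{field,finite} poly set" where
  "polys_below m = {g. g = 0 \<or> int (degree g) \<le> m - 1}"

text \<open>Irreducibles are not normalised: all associates are included.\<close>

definition irreds :: "nat \<Rightarrow> 'a::{field,finite} poly set" where
  "irreds k = {g. irreducible g \<and> k \<le> degree g \<and> degree g \<le> k + 1}"

definition multiplicative :: "('a::{field,finite} poly \<Rightarrow> complex) \<Rightarrow> bool" where
  "multiplicative \<nu> \<longleftrightarrow> (\<forall>g h. coprime g h \<longrightarrow> \<nu> (g * h) = \<nu> g * \<nu> h)"

definition correlation_sum :: "('a::{field,finite} poly \<Rightarrow> complex) \<Rightarrow> nat \<Rightarrow> nat \<Rightarrow> real" where
  "correlation_sum f n k =
     (\<Sum>a\<in>irreds k. \<Sum>b\<in>irreds k.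
        cmod (\<Sum>g\<in>polys_below (min (int n - int (degree a)) (int n - int (degree b))).
                f (a * g) * cnj (f (b * g))))"

end

theory Submission
  imports Defs "HOL-Computational_Algebra.Polynomial_Factorial" "HOL-Analysis.Convex"
begin

text \<open>
  Write \<open>|p| = q\<^sup>d\<close> with \<open>d = deg p\<close>. Let \<open>Q\<close> be the set of irreducibles of degree between
  \<open>\<phi>(n)\<close> and a large constant multiple of it, let \<open>L\<close> be the sum of \<open>1/|p|\<close> over \<open>Q\<close> and
  \<open>\<omega>(g)\<close> the number of \<open>p \<in> Q\<close> dividing \<open>g\<close>. A Chebyshev bound makes \<open>L\<close> as large as desired,
  uniformly in \<open>n\<close>. By the Turan--Kubilius inequality \<open>\<omega>\<close> is close to \<open>L\<close> on average, so that
  \<open>L \<Sum> \<nu>(g) f(g)\<close> is approximately \<open>\<Sum> \<omega>(g) \<nu>(g) f(g)\<close>, which is the sum of \<open>\<nu>(ph) f(ph)\<close> over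
  pairs \<open>p \<in> Q\<close>, \<open>h\<close>. Replacing \<open>\<nu>(ph)\<close> by \<open>\<nu>(p) \<nu>(h)\<close> costs only the few pairs with
  \<open>p dvd h\<close>, and Cauchy--Schwarz in \<open>h\<close>, applied to the \<open>p\<close> of degrees \<open>k, k + 1\<close>, leaves the
  correlations that the hypothesis controls. Because \<open>\<phi>(n) = o(n)\<close>, all degrees involved stay
  below \<open>n/2\<close>.
\<close>

subsection \<open>Counting polynomials\<close>

lemma two_le_card_field: "2 \<le> CARD('a::{field,finite})"
proof -
  have "card {0, 1 :: 'a} \<le> CARD('a)"
    by (rule card_mono) auto
  then show ?thesis by simp
qed

lemma zero_in_polys_below [simp]: "0 \<in> polys_below m"
  by (simp add: polys_below_def)

lemma polys_below_nonpos: "m \<le> 0 \<Longrightarrow> polys_below m = {0}"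
  by (auto simp: polys_below_def)

lemma polys_below_mono: "m \<le> n \<Longrightarrow> polys_below m \<subseteq> polys_below n"
  by (auto simp: polys_below_def)

lemma polys_below_Int: "polys_below m \<inter> polys_below n = polys_below (min m n)"
  by (auto simp: polys_below_def)

text \<open>Splitting off the constant coefficient; each step of the induction that counts
  \<open>polys_below\<close> thus gains a factor \<open>CARD('a)\<close>.\<close>

lemma polys_below_Suc:
  "polys_below (int (Suc n)) = (\<lambda>(a, g). pCons a g) ` (UNIV \<times> polys_below (int n))"
proof (intro set_eqI iffI)
  fix g :: "'a poly"
  assume g: "g \<in> polys_below (int (Suc n))"
  obtain a h where gh: "g = pCons a h" by (cases g)
  with g have "h \<in> polys_below (int n)"
    by (auto simp: polys_below_def split: if_splits)
  with gh show "g \<in> (\<lambda>(a, g). pCons a g) ` (UNIV \<times> polys_below (int n))" by auto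
qed (auto simp: polys_below_def split: if_splits)

lemma card_polys_below_nat:
  "finite (polys_below (int n) :: 'a::{field,finite} poly set) \<and>
   card (polys_below (int n) :: 'a poly set) = CARD('a) ^ n"
proof (induction n)
  case 0
  then show ?case by (simp add: polys_below_nonpos)
next
  case (Suc n)
  have "inj_on (\<lambda>(a, g). pCons a g) (UNIV \<times> polys_below (int n) :: ('a \<times> 'a poly) set)"
    by (auto intro!: inj_onI)
  with Suc show ?case
    unfolding polys_below_Suc by (simp add: card_image card_cartesian_product)
qed

text \<open>For \<open>m \<le> 0\<close> the set is \<open>{0}\<close> and \<open>nat m = 0\<close>,
  so the formula correctly gives 1.\<close>

lemma
  shows finite_polys_below [simp]: "finite (polys_below m :: 'a::{field,finite} poly set)"
    and card_polys_below: "card (polys_below m :: 'a poly set) = CARD('a) ^ nat m"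
  using card_polys_below_nat[of "nat m", where 'a = 'a] polys_below_nonpos[of m, where 'a = 'a]
  by (cases "m \<le> 0"; simp)+

section \<open>Multiples of a fixed polynomial and its norm\<close>

lemma polys_below_multiples:
  assumes "p \<noteq> 0"
  shows "{g \<in> polys_below m. p dvd g} = (*) p ` polys_below (m - int (degree p))"
proof (intro set_eqI iffI)
  fix g assume "g \<in> {g \<in> polys_below m. p dvd g}"
  then obtain h where "g = p * h" "p * h \<in> polys_below m" by (auto elim: dvdE)
  with assms have "g = p * h" "h \<in> polys_below (m - int (degree p))"
    by (cases "h = 0"; auto simp: polys_below_def degree_mult_eq)+
  then show "g \<in> (*) p ` polys_below (m - int (degree p))" by (rule image_eqI)
next
  fix g assume "g \<in> (*) p ` polys_below (m - int (degree p))"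
  then obtain h where "g = p * h" "h \<in> polys_below (m - int (degree p))" by auto
  with assms show "g \<in> {g \<in> polys_below m. p dvd g}"
    by (cases "h = 0"; auto simp: polys_below_def degree_mult_eq)
qed

lemma sum_polys_below_multiples:
  assumes "p \<noteq> 0"
  shows "(\<Sum>g \<in> {g \<in> polys_below m. p dvd g}. F g)
    = (\<Sum>h \<in> polys_below (m - int (degree p)). F (p * h))"
  unfolding polys_below_multiples[OF assms]
  by (subst sum.reindex) (use assms in \<open>auto intro: inj_onI\<close>)

lemma card_polys_below_multiples:
  fixes p :: "'a::{field,finite} poly"
  assumes "p \<noteq> 0"
  shows "card {g \<in> polys_below m. p dvd g} = CARD('a) ^ nat (m - int (degree p))"
  unfolding polys_below_multiples[OF assms]
  by (subst card_image) (use assms in \<open>auto intro: inj_onI simp: card_polys_below\<close>)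

text \<open>The number of residues modulo a nonzero \<open>p\<close>. Since
  \<open>degree 0 = 0\<close>, the value at 0 is 1, so the norm is always positive.\<close>

definition pnorm :: "'a::{field,finite} poly \<Rightarrow> real" where
  "pnorm p = real CARD('a) ^ degree p"

lemma pnorm_pos [simp]: "pnorm p > 0"
  by (simp add: pnorm_def)

lemma pnorm_nonzero [simp]: "pnorm p \<noteq> 0"
  by (simp add: pnorm_def)

lemma two_power_le_pnorm: "2 ^ degree p \<le> pnorm p"
  unfolding pnorm_def using two_le_card_field[where 'a = 'a] by (intro power_mono) auto

lemma pnorm_mult: "p \<noteq> 0 \<Longrightarrow> g \<noteq> 0 \<Longrightarrow> pnorm (p * g) = pnorm p * pnorm g"
  by (simp add: pnorm_def degree_mult_eq power_add)

lemma card_multiples_eq: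
  fixes p :: "'a::{field,finite} poly"
  assumes "p \<noteq> 0" "degree p \<le> n"
  shows "real (card {g \<in> polys_below (int n). p dvd g}) = real CARD('a) ^ n / pnorm p"
proof -
  have "real CARD('a) ^ nat (int n - int (degree p)) = real CARD('a) ^ n / pnorm p"
    using assms by (simp add: pnorm_def power_diff nat_diff_distrib)
  then show ?thesis
    by (simp add: card_polys_below_multiples[OF assms(1)])
qed

text \<open>Zero is a multiple of every \<open>p\<close> and would break the bound when
  \<open>degree p > n\<close>, where the right side drops below 1. Without zero the bound holds for
  every degree, so it applies to arbitrary powers \<open>p ^ j\<close>.\<close>

lemma card_nonzero_multiples_le:
  fixes p :: "'a::{field,finite} poly"
  assumes "p \<noteq> 0"
  shows "real (card {g \<in> polys_below (int n) - {0}. p dvd g}) \<le> real CARD('a) ^ n / pnorm p"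
proof (cases "degree p \<le> n")
  case True
  have "card {g \<in> polys_below (int n) - {0}. p dvd g} \<le> card {g \<in> polys_below (int n). p dvd g}"
    by (intro card_mono) auto
  then show ?thesis
    using card_multiples_eq[OF assms True] by linarith
next
  case False
  have "{g \<in> polys_below (int n) - {0}. p dvd g} = {}"
    using False by (auto simp: polys_below_def dest: dvd_imp_degree_le)
  then have "real (card {g \<in> polys_below (int n) - {0}. p dvd g}) = 0" by (simp only: card.empty of_nat_0)
  then show ?thesis by (simp only:) (simp add: pnorm_def)
qed

subsection \<open>Irreducible divisors\<close>

text \<open>The units of the polynomial ring are the nonzero constants, so this is the full
  associate class. As irreducibles are not normalised, each prime is counted
  \<open>CARD('a) - 1\<close> times, which explains this factor below.\<close>

definition associates :: "'a::{field,finite} poly \<Rightarrow> 'a poly set" where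
  "associates p = (\<lambda>c. smult c p) ` (- {0})"

lemma finite_associates [simp]: "finite (associates p)"
  by (simp add: associates_def)

lemma card_associates:
  fixes p :: "'a::{field,finite} poly"
  assumes "p \<noteq> 0"
  shows "card (associates p) = CARD('a) - 1"
proof -
  have "inj_on (\<lambda>c. smult c p) (- {0})"
  proof (rule inj_onI)
    fix x y assume "smult x p = smult y p"
    then have "smult (x - y) p = 0" by (simp add: smult_diff_left)
    with assms show "x = y" by simp
  qed
  then show ?thesis by (simp add: associates_def card_image Compl_eq_Diff_UNIV)
qed

lemma degree_associates: "p' \<in> associates p \<Longrightarrow> degree p' = degree p"
  by (auto simp: associates_def split: if_splits)

lemma dvd_associates: "p' \<in> associates p \<Longrightarrow> p' dvd g \<longleftrightarrow> p dvd g"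
  by (auto simp: associates_def smult_dvd_iff)

lemma irreducible_associates:
  assumes "irreducible p" "p' \<in> associates p"
  shows "irreducible p'"
proof (rule irreducible_mono[OF assms(1)])
  show "p' dvd p" using dvd_associates[OF assms(2)] by simp
  have "\<not> p dvd 1" using assms(1) by (rule irreducible_not_unit)
  then show "\<not> p' dvd 1" using dvd_associates[OF assms(2)] by simp
qed

lemma irreducible_dvd_imp_associates:
  assumes "irreducible p" "irreducible p'" "p' dvd p"
  shows "p' \<in> associates p"
proof -
  obtain u where u: "p = p' * u" using assms(3) by (rule dvdE)
  with assms have "u dvd 1" by (auto simp: irreducible_def)
  then obtain c where c: "u = [:c:]" "c dvd 1" by (auto simp: is_unit_poly_iff)
  then have c0: "c \<noteq> 0" by auto
  have "p' = smult (inverse c) p" using u c c0 by simp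
  then show ?thesis
    unfolding associates_def by (rule image_eqI) (use c0 in simp)
qed

lemma irreducible_poly_imp_prime_elem: "irreducible p \<Longrightarrow> prime_elem (p :: 'a::field poly)"
  by (rule field_poly_irreducible_imp_prime)

lemma irreducible_degree_pos: "irreducible (p :: 'a::field poly) \<Longrightarrow> degree p > 0"
  using is_unit_iff_degree[of p] by (auto simp: irreducible_def)

lemma exists_irreducible_dvd:
  fixes g :: "'a::field poly"
  assumes "degree g > 0"
  shows "\<exists>p. irreducible p \<and> p dvd g"
  using assms
proof (induction "degree g" arbitrary: g rule: less_induct)
  case less
  show ?case
  proof (cases "irreducible g")
    case False
    have "g \<noteq> 0" using less.prems by auto
    then have "\<not> g dvd 1" using less.prems is_unit_iff_degree[of g] by auto
    with False \<open>g \<noteq> 0\<close> obtain a b where ab: "g = a * b" "\<not> a dvd 1" "\<not> b dvd 1"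
      by (auto simp: irreducible_def)
    with \<open>g \<noteq> 0\<close> have "a \<noteq> 0" "b \<noteq> 0" by auto
    with ab is_unit_iff_degree have "degree a > 0" "degree b > 0" by auto
    with ab \<open>a \<noteq> 0\<close> \<open>b \<noteq> 0\<close> have "degree a < degree g" by (simp add: degree_mult_eq)
    with less.hyps[of a] \<open>degree a > 0\<close> ab show ?thesis by (auto intro: dvd_mult2)
  qed auto
qed

section \<open>Degree sums over irreducible and prime power divisors\<close>

lemma finite_irreducible_divisors:
  fixes g :: "'a::{field,finite} poly"
  assumes "g \<noteq> 0"
  shows "finite {p. irreducible p \<and> p dvd g}"
proof (rule finite_subset)
  show "{p. irreducible p \<and> p dvd g} \<subseteq> polys_below (int (degree g) + 1)"
    using assms by (auto simp: polys_below_def dest: dvd_imp_degree_le)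
qed simp

lemma sum_degree_associates:
  fixes p :: "'a::{field,finite} poly"
  assumes "p \<noteq> 0"
  shows "(\<Sum>p'\<in>associates p. degree p') = (CARD('a) - 1) * degree p"
proof -
  have "(\<Sum>p'\<in>associates p. degree p') = (\<Sum>p'\<in>associates p. degree p)"
    by (intro sum.cong) (auto simp: degree_associates)
  then show ?thesis by (simp add: card_associates[OF assms])
qed

text \<open>Write \<open>g = p * h\<close> with \<open>p\<close> irreducible. By primality an
  irreducible divisor of \<open>g\<close> is an associate of \<open>p\<close> or divides
  \<open>h\<close>; the associates contribute \<open>(CARD('a) - 1) * degree p\<close>, and
  induction handles \<open>h\<close>. The two sets may overlap, hence only an inequality.\<close>

lemma sum_degree_irreducible_divisors_le:
  fixes g :: "'a::{field,finite} poly"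
  assumes "g \<noteq> 0"
  shows "(\<Sum>p | irreducible p \<and> p dvd g. degree p) \<le> (CARD('a) - 1) * degree g"
  using assms
proof (induction "degree g" arbitrary: g rule: less_induct)
  case less
  show ?case
  proof (cases "degree g = 0")
    case True
    then have "g dvd 1" using less.prems is_unit_iff_degree by blast
    then have "{p. irreducible p \<and> p dvd g} = {}"
      using dvd_trans irreducible_not_unit by blast
    then show ?thesis by (simp only: sum.empty)
  next
    case False
    then obtain p where p: "irreducible p" "p dvd g" using exists_irreducible_dvd by blast
    then obtain h where h: "g = p * h" by (auto elim: dvdE)
    with less.prems have nz: "p \<noteq> 0" "h \<noteq> 0" by auto
    have deg: "degree g = degree p + degree h" using h nz by (simp add: degree_mult_eq)
    have sub: "{p. irreducible p \<and> p dvd g} \<subseteq> associates p \<union> {p. irreducible p \<and> p dvd h}"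
    proof
      fix p' assume "p' \<in> {p. irreducible p \<and> p dvd g}"
      then have p': "irreducible p'" "p' dvd p \<or> p' dvd h"
        using irreducible_poly_imp_prime_elem[of p'] h by (auto simp: prime_elem_dvd_mult_iff)
      then show "p' \<in> associates p \<union> {p. irreducible p \<and> p dvd h}"
        using irreducible_dvd_imp_associates[OF p(1) p'(1)] by auto
    qed
    have "(\<Sum>p | irreducible p \<and> p dvd g. degree p)
        \<le> (\<Sum>p \<in> associates p \<union> {p. irreducible p \<and> p dvd h}. degree p)"
      using finite_irreducible_divisors[OF nz(2)] sub by (intro sum_mono2) auto
    also have "\<dots> \<le> (\<Sum>p\<in>associates p. degree p) + (\<Sum>p | irreducible p \<and> p dvd h. degree p)"
      using sum.union_inter[OF finite_associates finite_irreducible_divisors[OF nz(2)], of degree p]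
      by linarith
    also have "\<dots> \<le> (CARD('a) - 1) * degree p + (CARD('a) - 1) * degree h"
      using less.hyps[of h] deg nz irreducible_degree_pos[OF p(1)]
      by (simp add: sum_degree_associates)
    finally show ?thesis using deg by (simp add: algebra_simps)
  qed
qed

text \<open>Pairs record the exponent, so an irreducible \<open>p\<close> occurs as often as its
  multiplicity in \<open>g\<close>. The sum of \<open>degree p\<close> over the pairs is the
  analogue of the sum of the von Mangoldt function over the divisors of an integer.\<close>

definition prime_power_divisors :: "'a::{field,finite} poly \<Rightarrow> ('a poly \<times> nat) set" where
  "prime_power_divisors g = {(p, j). irreducible p \<and> j > 0 \<and> p ^ j dvd g}"

lemma prime_power_divisors_subset:
  fixes g :: "'a::{field,finite} poly"
  assumes "g \<noteq> 0"
  shows "prime_power_divisors g \<subseteq> {p. irreducible p \<and> degree p \<le> degree g} \<times> {1..degree g}"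
proof (rule subrelI)
  fix p :: "'a poly" and j :: nat
  assume "(p, j) \<in> prime_power_divisors g"
  then have p: "irreducible p" "0 < j" "p ^ j dvd g" by (auto simp: prime_power_divisors_def)
  from p(1) have "p \<noteq> 0" "degree p > 0" using irreducible_degree_pos by auto
  have "degree (p ^ j) \<le> degree g" using p assms by (intro dvd_imp_degree_le) auto
  then have le: "j * degree p \<le> degree g" using \<open>p \<noteq> 0\<close> by (simp add: degree_power_eq mult.commute)
  have "degree p \<le> j * degree p" "j \<le> j * degree p" using p \<open>degree p > 0\<close> by auto
  then have "degree p \<le> degree g" "j \<le> degree g" using le by linarith+
  with p show "(p, j) \<in> {p. irreducible p \<and> degree p \<le> degree g} \<times> {1..degree g}" by simp
qed

lemma finite_irreducible_degree_le: "finite {p :: 'a::{field,finite} poly. irreducible p \<and> degree p \<le> x}"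
proof (rule finite_subset)
  show "{p :: 'a poly. irreducible p \<and> degree p \<le> x} \<subseteq> polys_below (int x + 1)"
    by (auto simp: polys_below_def)
qed simp

lemma finite_prime_power_divisors: "g \<noteq> 0 \<Longrightarrow> finite (prime_power_divisors g)"
  by (rule finite_subset[OF prime_power_divisors_subset])
     (auto intro: finite_irreducible_degree_le)

text \<open>Passing from \<open>h\<close> to \<open>g = p * h\<close> raises the multiplicity of
  \<open>p\<close>: each associate of \<open>p\<close> yields a new pair, and together these supply
  the increase \<open>(CARD('a) - 1) * degree p\<close>.\<close>

lemma sum_degree_prime_power_divisors_ge:
  fixes g :: "'a::{field,finite} poly"
  assumes "g \<noteq> 0"
  shows "(CARD('a) - 1) * degree g \<le> (\<Sum>(p, j) \<in> prime_power_divisors g. degree p)"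
  using assms
proof (induction "degree g" arbitrary: g rule: less_induct)
  case less
  show ?case
  proof (cases "degree g = 0")
    case False
    then obtain p where p: "irreducible p" "p dvd g" using exists_irreducible_dvd by blast
    then obtain h where h: "g = p * h" by (auto elim: dvdE)
    with less.prems have nz: "p \<noteq> 0" "h \<noteq> 0" by auto
    have deg: "degree g = degree p + degree h" using h nz by (simp add: degree_mult_eq)
    define J where "J = {j. p ^ j dvd h}"
    have "J \<subseteq> {..degree h}"
    proof
      fix j assume "j \<in> J"
      then have "degree (p ^ j) \<le> degree h" unfolding J_def using nz by (auto intro: dvd_imp_degree_le)
      then have "j * degree p \<le> degree h" using nz by (simp add: degree_power_eq mult.commute)
      moreover have "j \<le> j * degree p" using irreducible_degree_pos[OF p(1)] by simp
      ultimately show "j \<in> {..degree h}" by (metis atMost_iff le_trans)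
    qed
    then have finJ: "finite J" by (rule finite_subset) simp
    \<comment> \<open>The exact multiplicity of \<open>p\<close> in \<open>h\<close>: the exponent
      \<open>Suc m\<close> fails for \<open>h\<close> and succeeds for \<open>g\<close>.\<close>
    define m where "m = Max J"
    have "0 \<in> J" by (simp add: J_def)
    with finJ have "m \<in> J" unfolding m_def by (intro Max_in) auto
    have "Suc m \<notin> J" using Max_ge[OF finJ, of "Suc m"] by (auto simp: m_def)
    let ?N = "(\<lambda>p'. (p', Suc m)) ` associates p"
    have pow: "p' ^ Suc m dvd x \<longleftrightarrow> p ^ Suc m dvd x" if "p' \<in> associates p" for p' x
      using that by (auto simp: associates_def smult_power smult_dvd_iff simp del: power_Suc)
    have disj: "prime_power_divisors h \<inter> ?N = {}"
      using pow \<open>Suc m \<notin> J\<close> by (auto simp: prime_power_divisors_def J_def)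
    have "p ^ Suc m dvd g" using \<open>m \<in> J\<close> h by (auto simp: J_def)
    then have sub: "prime_power_divisors h \<union> ?N \<subseteq> prime_power_divisors g"
      using pow h irreducible_associates[OF p(1)] by (auto simp: prime_power_divisors_def)
    have inj: "inj_on (\<lambda>p'. (p', Suc m)) (associates p)" by (auto intro: inj_onI)
    have "(CARD('a) - 1) * degree g = (CARD('a) - 1) * degree h + (CARD('a) - 1) * degree p"
      using deg by (simp add: algebra_simps)
    also have "\<dots> \<le> (\<Sum>(p, j) \<in> prime_power_divisors h. degree p) + (\<Sum>p'\<in>associates p. degree p')"
      using less.hyps[of h] deg nz irreducible_degree_pos[OF p(1)]
      by (simp add: sum_degree_associates)
    also have "(\<Sum>p'\<in>associates p. degree p') = (\<Sum>(p, j) \<in> ?N. degree p)"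
      by (subst sum.reindex[OF inj]) auto
    also have "(\<Sum>(p, j) \<in> prime_power_divisors h. degree p) + (\<Sum>(p, j) \<in> ?N. degree p)
        = (\<Sum>(p, j) \<in> prime_power_divisors h \<union> ?N. degree p)"
      using finite_prime_power_divisors[OF nz(2)] disj by (intro sum.union_disjoint[symmetric]) auto
    also have "\<dots> \<le> (\<Sum>(p, j) \<in> prime_power_divisors g. degree p)"
      using finite_prime_power_divisors[OF less.prems] sub by (intro sum_mono2) auto
    finally show ?thesis .
  qed simp
qed

subsection \<open>Chebyshev and Mertens bounds\<close>

lemma geometric_sum_le:
  fixes t :: real
  assumes "0 \<le> t" "t \<le> 1 / 2"
  shows "(\<Sum>j\<in>{1..n}. t ^ j) \<le> 2 * t"
proof -
  \<comment> \<open>Keeping the subtracted tail makes the induction close.\<close>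
  have "(\<Sum>j\<in>{1..n}. t ^ j) \<le> 2 * t - 2 * t ^ Suc n"
  proof (induction n)
    case (Suc n)
    have "2 * t * t ^ Suc n \<le> 1 * t ^ Suc n"
      using assms by (intro mult_right_mono) auto
    with Suc show ?case by simp
  qed simp
  also have "\<dots> \<le> 2 * t" using assms by simp
  finally show ?thesis .
qed

text \<open>
  Average \<open>deg g\<close> over the nonzero \<open>g\<close> of degree at most \<open>x\<close>: the upper bound counts only the
  distinct irreducible divisors of \<open>g\<close>, the lower bound all prime powers dividing \<open>g\<close>.
\<close>

lemma sum_degree_div_pnorm_le:
  "(\<Sum>p :: 'a::{field,finite} poly | irreducible p \<and> degree p \<le> x. real (degree p) / pnorm p)
     \<le> 2 * (real CARD('a) - 1) * real x"
proof -
  define q where "q = real CARD('a)"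
  define G :: "'a poly set" where "G = polys_below (int (Suc x)) - {0}"
  define I :: "'a poly set" where "I = {p. irreducible p \<and> degree p \<le> x}"
  have q2: "q \<ge> 2" unfolding q_def using two_le_card_field[where 'a = 'a] by simp
  have fin: "finite G" "finite I" unfolding G_def I_def by (simp_all add: finite_irreducible_degree_le)
  have degG: "degree g \<le> x" "g \<noteq> 0" if "g \<in> G" for g
    using that by (auto simp: G_def polys_below_def)
  have "real (card G) \<le> q ^ Suc x"
    using card_mono[of "polys_below (int (Suc x))" G] card_polys_below[of "int (Suc x)", where 'a = 'a]
    unfolding G_def q_def by (metis Diff_subset finite_polys_below nat_int of_nat_le_iff of_nat_power)
  \<comment> \<open>The factor 2 pays for the removal of zero: the full count is at least
    \<open>q \<ge> 2\<close>, so lowering it by 1 leaves at least half.\<close>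
  have card_ge: "q ^ Suc x / (2 * pnorm p) \<le> real (card {g \<in> G. p dvd g})" if "p \<in> I" for p
  proof -
    from that have p: "p \<noteq> 0" "degree p \<le> x" by (auto simp: I_def)
    have eq: "{g \<in> G. p dvd g} = {g \<in> polys_below (int (Suc x)). p dvd g} - {0}"
      by (auto simp: G_def)
    have "real (card {g \<in> G. p dvd g}) = q ^ Suc x / pnorm p - 1"
      unfolding eq using card_multiples_eq[of p "Suc x"] p card_gt_0_iff[of "{g \<in> polys_below (int (Suc x)). p dvd g}"]
      by (subst card_Diff_singleton) (auto simp: q_def Suc_le_eq of_nat_diff simp del: of_nat_Suc)
    moreover have "q * pnorm p \<le> q * q ^ x"
      unfolding pnorm_def q_def[symmetric] using q2 p by (intro mult_left_mono power_increasing) auto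
    then have "q \<le> q ^ Suc x / pnorm p" by (simp add: field_simps)
    moreover have "q ^ Suc x / (2 * pnorm p) = (q ^ Suc x / pnorm p) / 2" by simp
    ultimately show ?thesis using q2 by linarith
  qed
  have "(\<Sum>p\<in>I. real (degree p) / pnorm p) * (q ^ Suc x / 2)
      = (\<Sum>p\<in>I. q ^ Suc x / (2 * pnorm p) * real (degree p))"
    unfolding sum_distrib_right by (intro sum.cong) (auto simp: mult_ac)
  also have "\<dots> \<le> (\<Sum>p\<in>I. real (card {g \<in> G. p dvd g}) * real (degree p))"
    by (intro sum_mono mult_right_mono card_ge) auto
  also have "\<dots> = (\<Sum>p\<in>I. \<Sum>g\<in>{g \<in> G. p dvd g}. real (degree p))" by simp
  also have "\<dots> = (\<Sum>g\<in>G. \<Sum>p\<in>{p \<in> I. p dvd g}. real (degree p))"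
    by (rule sum.swap_restrict[OF fin(2,1)])
  also have "\<dots> \<le> (\<Sum>g\<in>G. (q - 1) * real x)"
  proof (rule sum_mono)
    fix g assume g: "g \<in> G"
    have "{p \<in> I. p dvd g} = {p. irreducible p \<and> p dvd g}"
      using degG[OF g] dvd_imp_degree_le[of _ g] by (force simp: I_def)
    then have "(\<Sum>p\<in>{p \<in> I. p dvd g}. real (degree p)) = real (\<Sum>p | irreducible p \<and> p dvd g. degree p)"
      by simp
    also have "\<dots> \<le> real ((CARD('a) - 1) * degree g)"
      using sum_degree_irreducible_divisors_le[OF degG(2)[OF g]] by (rule of_nat_mono)
    also have "\<dots> \<le> real ((CARD('a) - 1) * x)"
      using degG(1)[OF g] by (intro of_nat_mono mult_left_mono) auto
    also have "\<dots> = (q - 1) * real x" by (simp add: q_def of_nat_diff Suc_le_eq)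
    finally show "(\<Sum>p\<in>{p \<in> I. p dvd g}. real (degree p)) \<le> (q - 1) * real x" .
  qed
  also have "\<dots> = real (card G) * ((q - 1) * real x)" by simp
  also have "\<dots> \<le> q ^ Suc x * ((q - 1) * real x)"
    using \<open>real (card G) \<le> q ^ Suc x\<close> q2 by (intro mult_right_mono) auto
  finally have "(\<Sum>p\<in>I. real (degree p) / pnorm p) * (q ^ Suc x / 2) \<le> (2 * (q - 1) * real x) * (q ^ Suc x / 2)"
    by (simp add: algebra_simps)
  then have "(\<Sum>p\<in>I. real (degree p) / pnorm p) \<le> 2 * (q - 1) * real x"
    by (rule mult_right_le_imp_le) (use q2 in simp)
  then show ?thesis by (simp add: I_def q_def)
qed

lemma sum_degree_div_pnorm_ge:
  "(real CARD('a) - 1) * real x / 4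
     \<le> (\<Sum>p :: 'a::{field,finite} poly | irreducible p \<and> degree p \<le> x. real (degree p) / pnorm p)"
proof -
  define q where "q = real CARD('a)"
  define G :: "'a poly set" where "G = polys_below (int (Suc x)) - {0}"
  define I :: "'a poly set" where "I = {p. irreducible p \<and> degree p \<le> x}"
  have q2: "q \<ge> 2" unfolding q_def using two_le_card_field[where 'a = 'a] by simp
  have fin: "finite G" "finite I" unfolding G_def I_def by (simp_all add: finite_irreducible_degree_le)
  have degG: "degree g \<le> x" "g \<noteq> 0" if "g \<in> G" for g
    using that by (auto simp: G_def polys_below_def)
  \<comment> \<open>The polynomials of top degree \<open>x\<close> are a proportion
    \<open>1 - 1/q\<close>, hence at least half, of all \<open>q ^ Suc x\<close>; their degrees
    alone give the lower bound.\<close>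
  define H :: "'a poly set" where "H = polys_below (int (Suc x)) - polys_below (int x)"
  have H: "H \<subseteq> G" "\<And>g. g \<in> H \<Longrightarrow> degree g = x" unfolding H_def G_def by (auto simp: polys_below_def)
  have "card H = CARD('a) ^ Suc x - CARD('a) ^ x"
    unfolding H_def using polys_below_mono[of "int x" "int (Suc x)", where 'a = 'a]
    by (subst card_Diff_subset) (auto simp: card_polys_below nat_add_distrib)
  then have "real (card H) = q ^ Suc x - q ^ x"
    by (simp add: q_def of_nat_diff)
  moreover have "2 * q ^ x \<le> q * q ^ x" using q2 by (intro mult_right_mono) auto
  ultimately have cardH: "q ^ Suc x / 2 \<le> real (card H)" by simp
  have "q ^ Suc x / 2 * ((q - 1) * real x) \<le> real (card H) * ((q - 1) * real x)"
    using cardH q2 by (intro mult_right_mono) auto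
  also have "\<dots> = (\<Sum>g\<in>H. (q - 1) * real (degree g))" using H by simp
  also have "\<dots> \<le> (\<Sum>g\<in>G. (q - 1) * real (degree g))"
    using q2 H fin by (intro sum_mono2) auto
  also have "\<dots> \<le> (\<Sum>g\<in>G. \<Sum>y\<in>{y \<in> I \<times> {1..x}. fst y ^ snd y dvd g}. real (degree (fst y)))"
  proof (rule sum_mono)
    fix g assume g: "g \<in> G"
    \<comment> \<open>A box independent of \<open>g\<close>, so that the order of summation can be
      exchanged.\<close>
    have "prime_power_divisors g \<subseteq> I \<times> {1..x}"
      using prime_power_divisors_subset[OF degG(2)[OF g]] degG(1)[OF g] by (force simp: I_def)
    then have eq: "{y \<in> I \<times> {1..x}. fst y ^ snd y dvd g} = prime_power_divisors g"
      by (auto simp: prime_power_divisors_def I_def)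
    have "(q - 1) * real (degree g) = real ((CARD('a) - 1) * degree g)"
      by (simp add: q_def of_nat_diff Suc_le_eq)
    also have "\<dots> \<le> real (\<Sum>(p, j) \<in> prime_power_divisors g. degree p)"
      using sum_degree_prime_power_divisors_ge[OF degG(2)[OF g]] by (rule of_nat_mono)
    finally show "(q - 1) * real (degree g) \<le> (\<Sum>y\<in>{y \<in> I \<times> {1..x}. fst y ^ snd y dvd g}. real (degree (fst y)))"
      unfolding eq by (simp add: case_prod_beta)
  qed
  also have "\<dots> = (\<Sum>y\<in>I \<times> {1..x}. \<Sum>g\<in>{g \<in> G. fst y ^ snd y dvd g}. real (degree (fst y)))"
    using fin by (intro sum.swap_restrict) auto
  also have "\<dots> = (\<Sum>p\<in>I. \<Sum>j\<in>{1..x}. real (card {g \<in> G. p ^ j dvd g}) * real (degree p))"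
    by (simp add: sum.cartesian_product case_prod_beta)
  also have "\<dots> \<le> (\<Sum>p\<in>I. q ^ Suc x * (2 * (real (degree p) / pnorm p)))"
  proof (rule sum_mono)
    fix p assume "p \<in> I"
    then have p: "irreducible p" "p \<noteq> 0" by (auto simp: I_def)
    \<comment> \<open>Irreducibles have positive degree, so the geometric series in
      \<open>1 / pnorm p\<close> has ratio at most 1/2: higher powers at most double the bound
      coming from \<open>j = 1\<close>.\<close>
    have "2 ^ 1 \<le> (2 :: real) ^ degree p"
      using irreducible_degree_pos[OF p(1)] by (intro power_increasing) auto
    with two_power_le_pnorm[of p] have "2 \<le> pnorm p" by simp
    then have t: "0 \<le> 1 / pnorm p" "1 / pnorm p \<le> 1 / 2" by (auto intro: divide_left_mono)
    have "(\<Sum>j\<in>{1..x}. real (card {g \<in> G. p ^ j dvd g}) * real (degree p))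
        \<le> (\<Sum>j\<in>{1..x}. (q ^ Suc x * (1 / pnorm p) ^ j) * real (degree p))"
    proof (intro sum_mono mult_right_mono)
      fix j
      have "pnorm (p ^ j) = pnorm p ^ j"
        using p by (simp add: pnorm_def degree_power_eq power_mult[symmetric] mult.commute)
      then show "real (card {g \<in> G. p ^ j dvd g}) \<le> q ^ Suc x * (1 / pnorm p) ^ j"
        using card_nonzero_multiples_le[of "p ^ j" "Suc x"] p
        by (simp add: G_def q_def power_one_over divide_inverse power_inverse)
    qed auto
    also have "\<dots> = q ^ Suc x * real (degree p) * (\<Sum>j\<in>{1..x}. (1 / pnorm p) ^ j)"
      by (simp add: sum_distrib_left mult_ac)
    also have "\<dots> \<le> q ^ Suc x * real (degree p) * (2 * (1 / pnorm p))"
      using q2 by (intro mult_left_mono geometric_sum_le t) auto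
    finally show "(\<Sum>j\<in>{1..x}. real (card {g \<in> G. p ^ j dvd g}) * real (degree p))
        \<le> q ^ Suc x * (2 * (real (degree p) / pnorm p))" by (simp add: mult_ac)
  qed
  also have "\<dots> = q ^ Suc x * (2 * (\<Sum>p\<in>I. real (degree p) / pnorm p))"
    by (simp add: sum_distrib_left)
  finally have "q ^ Suc x * ((q - 1) * real x / 2) \<le> q ^ Suc x * (2 * (\<Sum>p\<in>I. real (degree p) / pnorm p))"
    by (simp add: mult_ac)
  then have "(q - 1) * real x / 2 \<le> 2 * (\<Sum>p\<in>I. real (degree p) / pnorm p)"
    by (rule mult_left_le_imp_le) (use q2 in simp)
  then show ?thesis by (simp add: I_def q_def)
qed

text \<open>With \<open>q = CARD('a)\<close>, the lower bound at \<open>16 * X\<close> is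
  \<open>4 * (q - 1) * X\<close> and the upper bound at \<open>X\<close> is
  \<open>2 * (q - 1) * X\<close>; the ratio 16 makes the difference at least
  \<open>2 * (q - 1) * X\<close>. Degrees in the block are at most \<open>16 * X\<close>, and
  division by this leaves \<open>(q - 1) / 8\<close>.\<close>

lemma sum_inverse_pnorm_block_ge:
  assumes "X > 0"
  shows "(real CARD('a) - 1) / 8
     \<le> (\<Sum>p :: 'a::{field,finite} poly | irreducible p \<and> X < degree p \<and> degree p \<le> 16 * X. 1 / pnorm p)"
proof -
  define w :: "'a poly \<Rightarrow> real" where "w p = real (degree p) / pnorm p" for p
  define Q where "Q = {p :: 'a poly. irreducible p \<and> X < degree p \<and> degree p \<le> 16 * X}"
  let ?I = "\<lambda>x. {p :: 'a poly. irreducible p \<and> degree p \<le> x}"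
  have fin: "finite Q"
    by (rule finite_subset[OF _ finite_irreducible_degree_le[of "16 * X"]]) (auto simp: Q_def)
  have "?I (16 * X) = ?I X \<union> Q" "?I X \<inter> Q = {}" by (auto simp: Q_def)
  then have "sum w (?I (16 * X)) = sum w (?I X) + sum w Q"
    using fin finite_irreducible_degree_le[of X, where 'a = 'a] by (simp add: sum.union_disjoint)
  then have "2 * (real CARD('a) - 1) * real X \<le> sum w Q"
    using sum_degree_div_pnorm_ge[of "16 * X", where 'a = 'a] sum_degree_div_pnorm_le[of X, where 'a = 'a]
    by (simp add: w_def algebra_simps)
  also have "\<dots> \<le> (\<Sum>p\<in>Q. real (16 * X) * (1 / pnorm p))"
    unfolding w_def times_divide_eq_right mult_1_right
    by (intro sum_mono divide_right_mono) (auto simp: Q_def less_imp_le simp del: of_nat_mult)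
  also have "\<dots> = real (16 * X) * (\<Sum>p\<in>Q. 1 / pnorm p)" by (rule sum_distrib_left[symmetric])
  finally have "real X * ((real CARD('a) - 1) / 8) \<le> real X * (\<Sum>p\<in>Q. 1 / pnorm p)" by (simp add: field_simps)
  then have "(real CARD('a) - 1) / 8 \<le> (\<Sum>p\<in>Q. 1 / pnorm p)"
    by (rule mult_left_le_imp_le) (use assms in simp)
  then show ?thesis by (simp add: Q_def)
qed

text \<open>Join \<open>J\<close> consecutive blocks, each ending at 16 times its start. The bound
  is independent of \<open>X\<close>, which gives uniformity in the starting degree.\<close>

lemma sum_inverse_pnorm_ge:
  assumes "X > 0"
  shows "real J * (real CARD('a) - 1) / 8
     \<le> (\<Sum>p :: 'a::{field,finite} poly | irreducible p \<and> X < degree p \<and> degree p \<le> 16 ^ J * X. 1 / pnorm p)"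
proof (induction J)
  case (Suc J)
  let ?Q = "\<lambda>x y. {p :: 'a poly. irreducible p \<and> x < degree p \<and> degree p \<le> y}"
  define Y where "Y = 16 ^ J * X"
  have fin: "finite (?Q x y)" for x y
    by (rule finite_subset[OF _ finite_irreducible_degree_le[of y]]) auto
  have "X \<le> Y" by (simp add: Y_def)
  then have "?Q X (16 * Y) = ?Q X Y \<union> ?Q Y (16 * Y)" "?Q X Y \<inter> ?Q Y (16 * Y) = {}"
    by auto
  then have "(\<Sum>p\<in>?Q X (16 * Y). 1 / pnorm p)
      = (\<Sum>p\<in>?Q X Y. 1 / pnorm p) + (\<Sum>p\<in>?Q Y (16 * Y). 1 / pnorm p)"
    by (simp only: sum.union_disjoint[OF fin fin])
  moreover have "(real CARD('a) - 1) / 8 \<le> (\<Sum>p\<in>?Q Y (16 * Y). 1 / pnorm p)"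
    using assms by (intro sum_inverse_pnorm_block_ge) (simp add: Y_def)
  ultimately have "real (Suc J) * (real CARD('a) - 1) / 8 \<le> (\<Sum>p\<in>?Q X (16 * Y). 1 / pnorm p)"
    using Suc by (simp add: Y_def field_simps)
  then show ?case by (simp add: Y_def mult.assoc)
qed (simp add: sum_nonneg less_imp_le)

subsection \<open>The Turan--Kubilius inequality\<close>

text \<open>For non-associates, primality makes divisibility by both the same as divisibility by
  \<open>p * p'\<close>, whose degree is at most \<open>n\<close>, so the count is exact. For
  associates the two conditions coincide; the second summand covers this diagonal case.\<close>

lemma card_common_multiples_le:
  fixes p p' :: "'a::{field,finite} poly"
  assumes "irreducible p" "irreducible p'" "degree p + degree p' \<le> n"
  shows "real (card {g \<in> polys_below (int n). p dvd g \<and> p' dvd g})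
    \<le> real CARD('a) ^ n / (pnorm p * pnorm p')
       + (if p' \<in> associates p then real CARD('a) ^ n / pnorm p else 0)"
proof (cases "p' \<in> associates p")
  case True
  have "card {g \<in> polys_below (int n). p dvd g \<and> p' dvd g} \<le> card {g \<in> polys_below (int n). p dvd g}"
    by (intro card_mono) auto
  moreover have "real (card {g \<in> polys_below (int n). p dvd g}) = real CARD('a) ^ n / pnorm p"
    using assms by (intro card_multiples_eq) auto
  moreover have "0 \<le> real CARD('a) ^ n / (pnorm p * pnorm p')" by (simp add: less_imp_le)
  ultimately show ?thesis using True by simp
next
  case False
  have nz: "p \<noteq> 0" "p' \<noteq> 0" using assms by auto
  have "\<not> p' dvd p" using irreducible_dvd_imp_associates[OF assms(1,2)] False by blast
  then have "p * p' dvd g" if "p dvd g" "p' dvd g" for g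
    using that irreducible_poly_imp_prime_elem[OF assms(2)]
    by (auto elim!: dvdE[of p] simp: prime_elem_dvd_mult_iff intro: mult_dvd_mono)
  then have "{g \<in> polys_below (int n). p dvd g \<and> p' dvd g} = {g \<in> polys_below (int n). p * p' dvd g}"
    by (auto intro: dvd_mult_left dvd_mult_right)
  then show ?thesis
    using card_multiples_eq[of "p * p'" n] nz assms(3) False by (simp add: degree_mult_eq pnorm_mult)
qed

text \<open>Expand the square. With \<open>q = CARD('a)\<close>, the first moment is exactly
  \<open>q ^ n * L\<close>, the second at most \<open>q ^ n * L\<^sup>2\<close> plus the diagonal,
  and the terms in \<open>L\<^sup>2\<close> cancel. The zero polynomial stays in the sum, as it
  makes the counts of multiples exact.\<close>

lemma turan_kubilius:
  fixes Q :: "'a::{field,finite} poly set"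
  assumes fin: "finite Q" and irr: "\<And>p. p \<in> Q \<Longrightarrow> irreducible p"
    and deg: "\<And>p p'. p \<in> Q \<Longrightarrow> p' \<in> Q \<Longrightarrow> degree p + degree p' \<le> n"
  defines "L \<equiv> \<Sum>p\<in>Q. 1 / pnorm p"
  shows "(\<Sum>g\<in>polys_below (int n). (real (card {p \<in> Q. p dvd g}) - L)\<^sup>2)
    \<le> (real CARD('a) - 1) * L * real CARD('a) ^ n"
proof -
  define q where "q = real CARD('a)"
  define G :: "'a poly set" where "G = polys_below (int n)"
  define \<omega> where "\<omega> g = real (card {p \<in> Q. p dvd g})" for g
  have q2: "q \<ge> 2" unfolding q_def using two_le_card_field[where 'a = 'a] by simp
  have finG: "finite G" by (simp add: G_def)
  have "(\<Sum>g\<in>G. \<omega> g) = (\<Sum>g\<in>G. \<Sum>p\<in>{p \<in> Q. p dvd g}. 1)" by (simp add: \<omega>_def)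
  also have "\<dots> = (\<Sum>p\<in>Q. \<Sum>g\<in>{g \<in> G. p dvd g}. 1)"
    by (rule sum.swap_restrict[OF finG fin])
  also have "\<dots> = (\<Sum>p\<in>Q. q ^ n * (1 / pnorm p))"
  proof (intro sum.cong refl)
    fix p assume "p \<in> Q"
    with irr[of p] deg[of p p] have "p \<noteq> 0" "degree p \<le> n" by auto
    then show "(\<Sum>g\<in>{g \<in> G. p dvd g}. 1) = q ^ n * (1 / pnorm p)"
      using card_multiples_eq[of p n] by (simp add: G_def q_def)
  qed
  finally have first: "(\<Sum>g\<in>G. \<omega> g) = q ^ n * L" by (simp add: L_def sum_distrib_left)
  have "(\<Sum>g\<in>G. (\<omega> g)\<^sup>2) = (\<Sum>g\<in>G. \<Sum>y\<in>{y \<in> Q \<times> Q. fst y dvd g \<and> snd y dvd g}. 1)"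
  proof (intro sum.cong refl)
    fix g
    have "{y \<in> Q \<times> Q. fst y dvd g \<and> snd y dvd g} = {p \<in> Q. p dvd g} \<times> {p \<in> Q. p dvd g}"
      by auto
    then show "(\<omega> g)\<^sup>2 = (\<Sum>y\<in>{y \<in> Q \<times> Q. fst y dvd g \<and> snd y dvd g}. 1)"
      by (simp add: \<omega>_def card_cartesian_product power2_eq_square)
  qed
  also have "\<dots> = (\<Sum>y\<in>Q \<times> Q. \<Sum>g\<in>{g \<in> G. fst y dvd g \<and> snd y dvd g}. 1)"
    using finG fin by (intro sum.swap_restrict) auto
  also have "\<dots> = (\<Sum>p\<in>Q. \<Sum>p'\<in>Q. real (card {g \<in> G. p dvd g \<and> p' dvd g}))"
    by (simp add: sum.cartesian_product case_prod_beta)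
  also have "\<dots> \<le> (\<Sum>p\<in>Q. \<Sum>p'\<in>Q. q ^ n / (pnorm p * pnorm p')
       + (if p' \<in> associates p then q ^ n / pnorm p else 0))"
    unfolding G_def q_def using irr deg by (intro sum_mono card_common_multiples_le) auto
  also have "\<dots> = (\<Sum>p\<in>Q. \<Sum>p'\<in>Q. q ^ n * ((1 / pnorm p) * (1 / pnorm p')))
       + (\<Sum>p\<in>Q. \<Sum>p'\<in>Q. if p' \<in> associates p then q ^ n / pnorm p else 0)"
    by (simp add: sum.distrib)
  also have "(\<Sum>p\<in>Q. \<Sum>p'\<in>Q. q ^ n * ((1 / pnorm p) * (1 / pnorm p'))) = q ^ n * L\<^sup>2"
    unfolding L_def power2_eq_square sum_product by (simp add: sum_distrib_left)
  also have "(\<Sum>p\<in>Q. \<Sum>p'\<in>Q. if p' \<in> associates p then q ^ n / pnorm p else 0)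
      \<le> (\<Sum>p\<in>Q. (q - 1) * q ^ n * (1 / pnorm p))"
  proof (rule sum_mono)
    fix p assume "p \<in> Q"
    then have "p \<noteq> 0" using irr[of p] by auto
    \<comment> \<open>The diagonal consists of pairs of associates, which is where the factor
      \<open>q - 1\<close> of the variance arises.\<close>
    have "card (Q \<inter> associates p) \<le> CARD('a) - 1"
      using card_associates[OF \<open>p \<noteq> 0\<close>] card_mono[of "associates p" "Q \<inter> associates p"] by simp
    then have "real (card (Q \<inter> associates p)) \<le> q - 1"
      using two_le_card_field[where 'a = 'a] by (simp add: q_def)
    then have "real (card (Q \<inter> associates p)) * (q ^ n / pnorm p) \<le> (q - 1) * (q ^ n / pnorm p)"
      using q2 by (intro mult_right_mono) (auto simp: less_imp_le)
    moreover have "(\<Sum>p'\<in>Q. if p' \<in> associates p then q ^ n / pnorm p else 0)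
        = real (card (Q \<inter> associates p)) * (q ^ n / pnorm p)"
      using fin by (simp add: sum.If_cases)
    ultimately show "(\<Sum>p'\<in>Q. if p' \<in> associates p then q ^ n / pnorm p else 0)
      \<le> (q - 1) * q ^ n * (1 / pnorm p)" by simp
  qed
  also have "(\<Sum>p\<in>Q. (q - 1) * q ^ n * (1 / pnorm p)) = (q - 1) * q ^ n * L"
    by (simp only: L_def sum_distrib_left)
  finally have second: "(\<Sum>g\<in>G. (\<omega> g)\<^sup>2) \<le> q ^ n * L\<^sup>2 + (q - 1) * q ^ n * L" by simp
  have "(\<Sum>g\<in>G. (\<omega> g - L)\<^sup>2) = (\<Sum>g\<in>G. (\<omega> g)\<^sup>2 - 2 * L * \<omega> g + L\<^sup>2)"
    by (intro sum.cong) (auto simp: power2_eq_square algebra_simps)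
  also have "\<dots> = (\<Sum>g\<in>G. (\<omega> g)\<^sup>2) - 2 * L * (\<Sum>g\<in>G. \<omega> g) + real (card G) * L\<^sup>2"
    by (simp add: sum.distrib sum_subtractf sum_distrib_left)
  also have "\<dots> \<le> (q - 1) * L * q ^ n"
    using second unfolding first
    by (simp add: G_def card_polys_below q_def power2_eq_square algebra_simps)
  finally show ?thesis by (simp add: G_def q_def \<omega>_def)
qed

text \<open>Cauchy-Schwarz turns the variance into a mean absolute deviation of order
  \<open>sqrt L\<close>, small against \<open>L\<close> when \<open>L\<close> is large.\<close>

lemma turan_kubilius_abs:
  fixes Q :: "'a::{field,finite} poly set"
  assumes fin: "finite Q" and irr: "\<And>p. p \<in> Q \<Longrightarrow> irreducible p"
    and deg: "\<And>p p'. p \<in> Q \<Longrightarrow> p' \<in> Q \<Longrightarrow> degree p + degree p' \<le> n"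
  defines "L \<equiv> \<Sum>p\<in>Q. 1 / pnorm p"
  shows "(\<Sum>g\<in>polys_below (int n). \<bar>real (card {p \<in> Q. p dvd g}) - L\<bar>)
    \<le> real CARD('a) ^ n * sqrt ((real CARD('a) - 1) * L)"
proof -
  let ?s = "\<Sum>g\<in>polys_below (int n). \<bar>real (card {p \<in> Q. p dvd g}) - L\<bar>"
  have "?s\<^sup>2 \<le> (\<Sum>g\<in>polys_below (int n). (real (card {p \<in> Q. p dvd g}) - L)\<^sup>2)
      * real (card (polys_below (int n) :: 'a poly set))"
    using sum_squared_le_sum_of_squares[of
        "\<lambda>g. \<bar>real (card {p \<in> Q. p dvd g}) - L\<bar>" "polys_below (int n)"] by simp
  also have "\<dots> \<le> ((real CARD('a) - 1) * L * real CARD('a) ^ n) * real CARD('a) ^ n"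
    using turan_kubilius[OF fin irr deg]
    unfolding L_def by (simp add: card_polys_below mult_right_mono)
  finally have "?s \<le> sqrt (((real CARD('a) - 1) * L * real CARD('a) ^ n) * real CARD('a) ^ n)"
    by (intro real_le_rsqrt)
  also have "\<dots> = real CARD('a) ^ n * sqrt ((real CARD('a) - 1) * L)"
    by (simp add: real_sqrt_mult mult_ac flip: power2_eq_square power_mult_distrib)
  finally show ?thesis .
qed

subsection \<open>The Katai argument\<close>

text \<open>Summing over \<open>p\<close> first and using Cauchy-Schwarz in \<open>h\<close>
  eliminates the unknown \<open>v\<close>. Expanding the square leaves coefficients
  \<open>c a * cnj (c b)\<close> of modulus at most 1, so only correlations of \<open>y\<close>
  remain.\<close>

lemma bilinear_cauchy_schwarz:
  fixes c :: "'b \<Rightarrow> complex" and v :: "'c \<Rightarrow> complex" and y :: "'b \<Rightarrow> 'c \<Rightarrow> complex"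
  assumes "finite P" "finite G" and sub: "\<And>p. p \<in> P \<Longrightarrow> S p \<subseteq> G"
    and c: "\<And>p. cmod (c p) \<le> 1" and v: "\<And>h. cmod (v h) \<le> 1"
  shows "(cmod (\<Sum>p\<in>P. c p * (\<Sum>h\<in>S p. v h * y p h)))\<^sup>2
    \<le> real (card G) * (\<Sum>a\<in>P. \<Sum>b\<in>P. cmod (\<Sum>h\<in>S a \<inter> S b. y a h * cnj (y b h)))"
proof -
  \<comment> \<open>Extension by zero lets all inner sums run over the common set \<open>G\<close>;
    a product of two such terms lives on \<open>S a \<inter> S b\<close>.\<close>
  define z where "z p h = (if h \<in> S p then c p * y p h else 0)" for p h
  define F where "F h = (\<Sum>p\<in>P. z p h)" for h
  have "(\<Sum>p\<in>P. c p * (\<Sum>h\<in>S p. v h * y p h)) = (\<Sum>p\<in>P. \<Sum>h\<in>G. v h * z p h)"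
  proof (intro sum.cong refl)
    fix p assume "p \<in> P"
    then have "(\<Sum>h\<in>G. v h * z p h) = (\<Sum>h\<in>S p. v h * z p h)"
      using assms(2) sub by (intro sum.mono_neutral_right) (auto simp: z_def)
    then show "c p * (\<Sum>h\<in>S p. v h * y p h) = (\<Sum>h\<in>G. v h * z p h)"
      by (simp add: z_def sum_distrib_left mult_ac)
  qed
  also have "\<dots> = (\<Sum>h\<in>G. v h * F h)"
    unfolding F_def sum_distrib_left by (rule sum.swap)
  finally have "cmod (\<Sum>p\<in>P. c p * (\<Sum>h\<in>S p. v h * y p h)) \<le> (\<Sum>h\<in>G. cmod (F h))"
    using v by (auto intro!: sum_norm_le mult_left_le_one_le simp: norm_mult)
  then have "(cmod (\<Sum>p\<in>P. c p * (\<Sum>h\<in>S p. v h * y p h)))\<^sup>2 \<le> (\<Sum>h\<in>G. cmod (F h))\<^sup>2"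
    by (intro power_mono) auto
  also have "\<dots> \<le> (\<Sum>h\<in>G. (cmod (F h))\<^sup>2) * real (card G)"
    by (rule sum_squared_le_sum_of_squares)
  also have "(\<Sum>h\<in>G. (cmod (F h))\<^sup>2) \<le> (\<Sum>a\<in>P. \<Sum>b\<in>P. cmod (\<Sum>h\<in>S a \<inter> S b. y a h * cnj (y b h)))"
  proof -
    have "complex_of_real (\<Sum>h\<in>G. (cmod (F h))\<^sup>2) = (\<Sum>h\<in>G. \<Sum>a\<in>P. \<Sum>b\<in>P. z a h * cnj (z b h))"
      by (simp only: of_real_sum complex_norm_square F_def cnj_sum sum_product)
    also have "\<dots> = (\<Sum>a\<in>P. \<Sum>b\<in>P. \<Sum>h\<in>G. z a h * cnj (z b h))"
      by (subst sum.swap, intro sum.cong refl, rule sum.swap)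
    also have "\<dots> = (\<Sum>a\<in>P. \<Sum>b\<in>P. (c a * cnj (c b)) * (\<Sum>h\<in>S a \<inter> S b. y a h * cnj (y b h)))"
    proof (intro sum.cong refl)
      fix a b assume "a \<in> P" "b \<in> P"
      then have "(\<Sum>h\<in>G. z a h * cnj (z b h)) = (\<Sum>h\<in>S a \<inter> S b. z a h * cnj (z b h))"
        using assms(2) sub by (intro sum.mono_neutral_right) (auto simp: z_def)
      then show "(\<Sum>h\<in>G. z a h * cnj (z b h)) = (c a * cnj (c b)) * (\<Sum>h\<in>S a \<inter> S b. y a h * cnj (y b h))"
        by (simp add: z_def sum_distrib_left mult_ac)
    qed
    finally have "cmod (complex_of_real (\<Sum>h\<in>G. (cmod (F h))\<^sup>2))
        \<le> (\<Sum>a\<in>P. \<Sum>b\<in>P. cmod (\<Sum>h\<in>S a \<inter> S b. y a h * cnj (y b h)))"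
      using c by (auto intro!: sum_norm_le mult_left_le_one_le mult_le_one simp: norm_mult)
    then show ?thesis by (simp only: norm_of_real)
  qed
  finally show ?thesis by (simp add: mult.commute mult_right_mono)
qed

lemma irreducible_imp_coprime:
  fixes p :: "'a::field poly"
  assumes "irreducible p" "\<not> p dvd g"
  shows "coprime p g"
proof (rule coprimeI)
  fix d assume d: "d dvd p" "d dvd g"
  with assms(2) have "\<not> p dvd d" using dvd_trans by blast
  with irreducibleD'[OF assms(1) d(1)] show "d dvd 1" by blast
qed

lemma finite_irreds [simp]: "finite (irreds k)"
  by (rule finite_subset[OF _ finite_irreducible_degree_le[of "k + 1"]]) (auto simp: irreds_def)

text \<open>Degrees in \<open>irreds k\<close> reach \<open>k + 1\<close>, which costs one factor
  \<open>CARD('a)\<close>. The bound trades the cardinality in the correlation hypothesis for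
  weights \<open>1 / pnorm p\<close> that add up over blocks.\<close>

lemma card_irreds_div_le:
  "real (card (irreds k :: 'a::{field,finite} poly set)) / real CARD('a) ^ k
    \<le> real CARD('a) * (\<Sum>p\<in>(irreds k :: 'a poly set). 1 / pnorm p)"
proof -
  define q where "q = real CARD('a)"
  have q2: "q \<ge> 2" unfolding q_def using two_le_card_field[where 'a = 'a] by simp
  have "real (card (irreds k :: 'a poly set)) / q ^ k = (\<Sum>p\<in>(irreds k :: 'a poly set). 1 / q ^ k)"
    by simp
  also have "\<dots> \<le> (\<Sum>p\<in>(irreds k :: 'a poly set). q * (1 / pnorm p))"
  proof (rule sum_mono)
    fix p :: "'a poly" assume "p \<in> irreds k"
    then have "pnorm p \<le> q ^ Suc k"
      unfolding pnorm_def q_def[symmetric] using q2 by (intro power_increasing) (auto simp: irreds_def)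
    then show "1 / q ^ k \<le> q * (1 / pnorm p)" using q2 by (simp add: field_simps)
  qed
  finally show ?thesis by (simp only: q_def sum_distrib_left)
qed

text \<open>All ranges of \<open>h\<close> lie in \<open>polys_below (int n - int k)\<close>, as
  \<open>degree p \<ge> k\<close>, and two of them meet in the range with the minimum, as in
  \<open>correlation_sum\<close>. Cauchy-Schwarz and the hypothesis each give
  \<open>CARD('a) ^ (n - k)\<close>, and the root is taken of the product.\<close>

lemma bilinear_irreds_le:
  fixes \<nu> f :: "'a::{field,finite} poly \<Rightarrow> complex"
  assumes \<nu>: "\<And>g. cmod (\<nu> g) \<le> 1" and "k \<le> n" "0 \<le> \<epsilon>"
    and corr: "correlation_sum f n k
      \<le> \<epsilon> * ((real (card (irreds k :: 'a poly set)))\<^sup>2 * real CARD('a) powi (int n - int k))"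
  shows "cmod (\<Sum>p\<in>irreds k. \<nu> p * (\<Sum>h\<in>polys_below (int n - int (degree p)). \<nu> h * f (p * h)))
    \<le> real CARD('a) ^ n * (sqrt \<epsilon> * real CARD('a) * (\<Sum>p\<in>(irreds k :: 'a poly set). 1 / pnorm p))"
    (is "?lhs \<le> _")
proof -
  define q where "q = real CARD('a)"
  define P where "P = (irreds k :: 'a poly set)"
  have q2: "q \<ge> 2" unfolding q_def using two_le_card_field[where 'a = 'a] by simp
  have powi: "q powi (int n - int k) = q ^ (n - k)"
    using \<open>k \<le> n\<close> by (simp add: power_int_def nat_diff_distrib)
  have "?lhs\<^sup>2 \<le> real (card (polys_below (int n - int k) :: 'a poly set)) *
      (\<Sum>a\<in>P. \<Sum>b\<in>P. cmod (\<Sum>h\<in>polys_below (int n - int (degree a)) \<inter> polys_below (int n - int (degree b)).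
          f (a * h) * cnj (f (b * h))))"
    unfolding P_def using \<nu>
    by (intro bilinear_cauchy_schwarz polys_below_mono finite_irreds finite_polys_below) (auto simp: irreds_def)
  also have "\<dots> = q ^ (n - k) * correlation_sum f n k"
    using \<open>k \<le> n\<close> by (simp add: correlation_sum_def polys_below_Int P_def q_def card_polys_below nat_diff_distrib)
  also have "\<dots> \<le> q ^ (n - k) * (\<epsilon> * ((real (card P))\<^sup>2 * q ^ (n - k)))"
    using corr q2 unfolding P_def[symmetric] q_def[symmetric] powi by (intro mult_left_mono) auto
  also have "\<dots> = (sqrt \<epsilon> * (real (card P) * q ^ (n - k)))\<^sup>2"
    using \<open>0 \<le> \<epsilon>\<close> by (simp add: power2_eq_square algebra_simps)
  finally have "?lhs \<le> sqrt \<epsilon> * (real (card P) * q ^ (n - k))"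
    by (rule power2_le_imp_le) (use q2 \<open>0 \<le> \<epsilon>\<close> in simp)
  also have "real (card P) * q ^ (n - k) = q ^ n * (real (card P) / q ^ k)"
    using \<open>k \<le> n\<close> q2 by (simp add: power_diff)
  also have "sqrt \<epsilon> * \<dots> \<le> sqrt \<epsilon> * (q ^ n * (q * (\<Sum>p\<in>P. 1 / pnorm p)))"
    unfolding P_def q_def using \<open>0 \<le> \<epsilon>\<close> by (intro mult_left_mono card_irreds_div_le) auto
  finally show ?thesis by (simp only: P_def q_def mult_ac)
qed

text \<open>If \<open>p\<close> does not divide \<open>h\<close>, the two are coprime and the term
  vanishes. The \<open>h\<close> divisible by \<open>p\<close> number
  \<open>CARD('a) ^ (n - 2 * degree p)\<close>, and each contributes at most 2.\<close>

lemma multiplicative_defect_le: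
  fixes \<nu> f :: "'a::{field,finite} poly \<Rightarrow> complex"
  assumes mult: "multiplicative \<nu>" and \<nu>: "\<And>g. cmod (\<nu> g) \<le> 1" and f: "\<And>g. cmod (f g) \<le> 1"
    and p: "irreducible p" "2 * degree p \<le> n"
  shows "cmod (\<Sum>h\<in>polys_below (int n - int (degree p)). (\<nu> (p * h) - \<nu> p * \<nu> h) * f (p * h))
    \<le> 2 * real CARD('a) ^ n / (pnorm p)\<^sup>2"
proof -
  let ?G = "polys_below (int n - int (degree p)) :: 'a poly set"
  have "p \<noteq> 0" using p by auto
  have "(\<Sum>h\<in>?G. (\<nu> (p * h) - \<nu> p * \<nu> h) * f (p * h))
      = (\<Sum>h\<in>{h \<in> ?G. p dvd h}. (\<nu> (p * h) - \<nu> p * \<nu> h) * f (p * h))"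
  proof (rule sum.mono_neutral_right)
    show "\<forall>h\<in>?G - {h \<in> ?G. p dvd h}. (\<nu> (p * h) - \<nu> p * \<nu> h) * f (p * h) = 0"
    proof
      fix h assume "h \<in> ?G - {h \<in> ?G. p dvd h}"
      then have "coprime p h" using irreducible_imp_coprime[OF p(1)] by auto
      then show "(\<nu> (p * h) - \<nu> p * \<nu> h) * f (p * h) = 0"
        using mult by (simp add: multiplicative_def)
    qed
  qed auto
  also have "cmod \<dots> \<le> (\<Sum>h\<in>{h \<in> ?G. p dvd h}. 2)"
  proof (rule sum_norm_le)
    fix h
    have "cmod (\<nu> (p * h) - \<nu> p * \<nu> h) \<le> 1 + 1"
      using \<nu> by (intro norm_triangle_le_diff add_mono) (auto simp: norm_mult intro: mult_le_one)
    then show "cmod ((\<nu> (p * h) - \<nu> p * \<nu> h) * f (p * h)) \<le> 2"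
      using mult_mono[OF _ f[of "p * h"], of "cmod (\<nu> (p * h) - \<nu> p * \<nu> h)" 2] by (simp add: norm_mult)
  qed
  also have "\<dots> = 2 * real CARD('a) ^ (n - 2 * degree p)"
  proof -
    have "nat (int n - int (degree p) - int (degree p)) = n - 2 * degree p" using p by simp
    then show ?thesis by (simp add: card_polys_below_multiples[OF \<open>p \<noteq> 0\<close>])
  qed
  also have "\<dots> = 2 * real CARD('a) ^ n / (pnorm p)\<^sup>2"
    using p by (simp add: power_diff pnorm_def power_mult[symmetric] mult.commute)
  finally show ?thesis .
qed

text \<open>The three error terms come from replacing the divisor count by its mean
  \<open>L\<close>, from the pairs with \<open>p dvd h\<close>, and from the correlations. The bound
  on \<open>X + 2 * I\<close> keeps the sum of any two degrees of irreducibles involved at most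
  \<open>n\<close>.\<close>

lemma katai_bound:
  fixes \<nu> f :: "'a::{field,finite} poly \<Rightarrow> complex"
  assumes mult: "multiplicative \<nu>" and \<nu>: "\<And>g. cmod (\<nu> g) \<le> 1" and f: "\<And>g. cmod (f g) \<le> 1"
    and \<epsilon>: "0 \<le> \<epsilon>" and n: "2 * (X + 2 * I) \<le> n"
    and corr: "\<And>i. i < I \<Longrightarrow> correlation_sum f n (X + 2 * i)
      \<le> \<epsilon> * ((real (card (irreds (X + 2 * i) :: 'a poly set)))\<^sup>2
              * real CARD('a) powi (int n - int (X + 2 * i)))"
  defines "L \<equiv> \<Sum>p :: 'a poly | irreducible p \<and> X \<le> degree p \<and> degree p < X + 2 * I. 1 / pnorm p"
  shows "L * cmod (\<Sum>g\<in>polys_below (int n). \<nu> g * f g)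
    \<le> real CARD('a) ^ n * (sqrt ((real CARD('a) - 1) * L) + 2 * L / 2 ^ X + sqrt \<epsilon> * real CARD('a) * L)"
proof -
  define q where "q = real CARD('a)"
  define Q where "Q = {p :: 'a poly. irreducible p \<and> X \<le> degree p \<and> degree p < X + 2 * I}"
  define G where "G = (polys_below (int n) :: 'a poly set)"
  define B where "B p = (polys_below (int n - int (degree p)) :: 'a poly set)" for p :: "'a poly"
  define S where "S = (\<Sum>g\<in>G. \<nu> g * f g)"
  define T where "T = (\<Sum>p\<in>Q. \<nu> p * (\<Sum>h\<in>B p. \<nu> h * f (p * h)))"
  define U where "U = (\<Sum>p\<in>Q. \<Sum>h\<in>B p. (\<nu> (p * h) - \<nu> p * \<nu> h) * f (p * h))"
  define \<omega> where "\<omega> g = card {p \<in> Q. p dvd g}" for g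
  have q2: "q \<ge> 2" unfolding q_def using two_le_card_field[where 'a = 'a] by simp
  have Q: "finite Q"
    by (rule finite_subset[OF _ finite_irreducible_degree_le[of "X + 2 * I"]]) (auto simp: Q_def)
  have L: "L = (\<Sum>p\<in>Q. 1 / pnorm p)" by (simp add: L_def Q_def)
  have "L \<ge> 0" unfolding L by (intro sum_nonneg) (simp add: less_imp_le)
  have "(\<Sum>g\<in>G. \<nu> g * f g * of_nat (\<omega> g)) = (\<Sum>g\<in>G. \<Sum>p\<in>{p \<in> Q. p dvd g}. \<nu> g * f g)"
    by (simp add: \<omega>_def mult.commute)
  also have "\<dots> = (\<Sum>p\<in>Q. \<Sum>g\<in>{g \<in> G. p dvd g}. \<nu> g * f g)"
    using Q by (intro sum.swap_restrict) (auto simp: G_def)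
  also have "\<dots> = (\<Sum>p\<in>Q. \<Sum>h\<in>B p. \<nu> (p * h) * f (p * h))"
    unfolding G_def B_def by (intro sum.cong sum_polys_below_multiples) (auto simp: Q_def)
  also have "\<dots> = T + U"
    by (simp add: T_def U_def sum_distrib_left sum.distrib[symmetric] algebra_simps)
  finally have weighted: "(\<Sum>g\<in>G. \<nu> g * f g * of_nat (\<omega> g)) = T + U" .

  have "of_real L * S - (T + U) = (\<Sum>g\<in>G. \<nu> g * f g * of_real (L - real (\<omega> g)))"
    unfolding weighted[symmetric] S_def
    by (simp add: sum_distrib_left sum_subtractf[symmetric] algebra_simps)
  also have "cmod \<dots> \<le> (\<Sum>g\<in>G. \<bar>real (\<omega> g) - L\<bar>)"
  proof (rule sum_norm_le)
    fix g
    have "cmod (\<nu> g * f g) \<le> 1" using \<nu> f by (auto simp: norm_mult intro: mult_le_one)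
    then have "cmod (\<nu> g * f g) * \<bar>L - real (\<omega> g)\<bar> \<le> 1 * \<bar>L - real (\<omega> g)\<bar>"
      by (intro mult_right_mono) auto
    then show "cmod (\<nu> g * f g * of_real (L - real (\<omega> g))) \<le> \<bar>real (\<omega> g) - L\<bar>"
      by (simp only: norm_mult norm_of_real) (simp add: abs_minus_commute)
  qed
  also have "\<dots> \<le> q ^ n * sqrt ((q - 1) * L)"
    unfolding G_def \<omega>_def L q_def using Q n by (intro turan_kubilius_abs) (auto simp: Q_def)
  finally have 1: "cmod (of_real L * S - (T + U)) \<le> q ^ n * sqrt ((q - 1) * L)" .

  \<comment> \<open>One factor \<open>1 / pnorm p\<close> of the defect is at most
    \<open>1 / 2 ^ X\<close> because \<open>degree p \<ge> X\<close>; the other sums to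
    \<open>L\<close>.\<close>
  have "cmod U \<le> (\<Sum>p\<in>Q. q ^ n * (2 / 2 ^ X) * (1 / pnorm p))"
    unfolding U_def
  proof (rule sum_norm_le)
    fix p assume p: "p \<in> Q"
    then have "cmod (\<Sum>h\<in>B p. (\<nu> (p * h) - \<nu> p * \<nu> h) * f (p * h)) \<le> 2 * q ^ n / (pnorm p)\<^sup>2"
      unfolding B_def q_def using n by (intro multiplicative_defect_le mult \<nu> f) (auto simp: Q_def)
    also have "\<dots> = q ^ n * (2 / pnorm p) * (1 / pnorm p)" by (simp add: power2_eq_square)
    also have "\<dots> \<le> q ^ n * (2 / 2 ^ X) * (1 / pnorm p)"
    proof -
      have "2 ^ X \<le> (2 :: real) ^ degree p" using p by (intro power_increasing) (auto simp: Q_def)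
      with two_power_le_pnorm[of p] have "2 ^ X \<le> pnorm p" by linarith
      then show ?thesis
        using q2 by (intro mult_right_mono mult_left_mono divide_left_mono) (auto simp: less_imp_le)
    qed
    finally show "cmod (\<Sum>h\<in>B p. (\<nu> (p * h) - \<nu> p * \<nu> h) * f (p * h)) \<le> q ^ n * (2 / 2 ^ X) * (1 / pnorm p)" .
  qed
  then have 2: "cmod U \<le> q ^ n * (2 / 2 ^ X) * L" by (simp only: L sum_distrib_left)

  \<comment> \<open>Each \<open>irreds k\<close> covers the two degrees \<open>k\<close> and
    \<open>k + 1\<close>, so steps of 2 partition the degree range.\<close>
  have Q_eq: "Q = (\<Union>i\<in>{..<I}. irreds (X + 2 * i))"
  proof (intro set_eqI iffI)
    fix p assume "p \<in> Q"
    then have "p \<in> irreds (X + 2 * ((degree p - X) div 2))" "(degree p - X) div 2 < I"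
      by (auto simp: Q_def irreds_def)
    then show "p \<in> (\<Union>i\<in>{..<I}. irreds (X + 2 * i))" by blast
  qed (auto simp: Q_def irreds_def)
  have split: "sum F Q = (\<Sum>i<I. sum F (irreds (X + 2 * i)))" for F :: "'a poly \<Rightarrow> 'b::comm_monoid_add"
    unfolding Q_eq by (intro sum.UNION_disjoint ballI finite_irreds) (auto simp: irreds_def)
  have "cmod T \<le> (\<Sum>i<I. q ^ n * (sqrt \<epsilon> * q * (\<Sum>p\<in>(irreds (X + 2 * i) :: 'a poly set). 1 / pnorm p)))"
    unfolding T_def split B_def q_def
    using n \<epsilon> by (intro sum_norm_le bilinear_irreds_le \<nu> corr) auto
  also have "\<dots> = q ^ n * (sqrt \<epsilon> * q * L)" by (simp only: L split sum_distrib_left)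
  finally have 3: "cmod T \<le> q ^ n * (sqrt \<epsilon> * q * L)" .

  have "L * cmod S = cmod ((of_real L * S - (T + U)) + T + U)"
    using \<open>L \<ge> 0\<close> by (simp add: norm_mult)
  also have "\<dots> \<le> cmod (of_real L * S - (T + U)) + cmod T + cmod U"
    by (intro norm_triangle_le add_right_mono) (simp add: norm_triangle_ineq)
  also have "\<dots> \<le> q ^ n * (sqrt ((q - 1) * L) + 2 * L / 2 ^ X + sqrt \<epsilon> * q * L)"
    using 1 2 3 by (simp add: algebra_simps)
  finally show ?thesis by (simp only: S_def G_def q_def)
qed

section \<open>Choice of parameters and conclusion\<close>

theorem theorem3p1:
  fixes \<nu> f :: "'a::{field,finite} poly \<Rightarrow> complex"
    and \<phi> :: "nat \<Rightarrow> real"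
  assumes "multiplicative \<nu>"
    and "\<And>g. cmod (\<nu> g) \<le> 1"
    and "\<And>g. cmod (f g) \<le> 1"
    and "\<And>n. \<phi> n \<ge> 0"
    and "filterlim \<phi> at_top at_top"
    and "\<phi> \<in> o(\<lambda>n. real n)"
    and "\<And>\<epsilon>. \<epsilon> > 0 \<Longrightarrow>
           \<forall>\<^sub>F n in at_top. \<forall>k::nat. \<phi> n \<le> real k \<and> real k \<le> \<phi> n + (\<phi> n)\<^sup>2 \<longrightarrow>
             correlation_sum f n k
               \<le> \<epsilon> * ((real (card (irreds k :: 'a poly set)))\<^sup>2 * real CARD('a) powi (int n - int k))"
  shows "(\<lambda>n. \<Sum>g\<in>polys_below (int n). \<nu> g * f g) \<in> o(\<lambda>n. of_nat CARD('a) ^ n)"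
proof (rule landau_o.smallI)
  fix \<delta> :: real
  assume "\<delta> > 0"
  define q where "q = real CARD('a)"
  have q2: "q \<ge> 2" unfolding q_def using two_le_card_field[where 'a = 'a] by simp
  \<comment> \<open>The constant 72 gives \<open>L \<ge> 9 * (q - 1) / \<delta>\<^sup>2\<close>,
    after division by the 8 of the Mertens bound, and hence
    \<open>sqrt ((q - 1) * L) \<le> \<delta> / 3 * L\<close>.\<close>
  define J where "J = nat \<lceil>72 / \<delta>\<^sup>2\<rceil>"
  \<comment> \<open>The degree range will end at \<open>C * X\<close>, with \<open>C\<close>
    independent of \<open>n\<close>.\<close>
  define C :: nat where "C = 1 + 2 * 16 ^ J"
  \<comment> \<open>Makes the correlation term exactly \<open>\<delta> / 3 * L\<close>.\<close>
  define \<epsilon> where "\<epsilon> = (\<delta> / (3 * q))\<^sup>2"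
  have J: "72 / \<delta>\<^sup>2 \<le> real J" unfolding J_def by (rule real_nat_ceiling_ge)
  have C: "real C \<ge> 1" by (simp add: C_def)
  have \<epsilon>: "\<epsilon> > 0" "sqrt \<epsilon> * q = \<delta> / 3" using \<open>\<delta> > 0\<close> q2 by (auto simp: \<epsilon>_def)
  \<comment> \<open>Since \<open>X \<le> 2 * \<phi> n\<close>, the bound \<open>2 * C\<close> puts
    \<open>C * X\<close> below \<open>(\<phi> n)\<^sup>2\<close>, inside the window. The bound
    \<open>6 / \<delta>\<close> controls \<open>2 / 2 ^ X\<close>, and the factor
    \<open>1 / (4 * C)\<close> in the next condition gives \<open>2 * C * X \<le> n\<close>.\<close>
  have "\<forall>\<^sub>F n in at_top. max (2 * real C) (6 / \<delta>) \<le> \<phi> n"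
    using assms(5) by (simp only: filterlim_at_top)
  moreover have "\<forall>\<^sub>F n in at_top. norm (\<phi> n) \<le> 1 / (4 * real C) * norm (real n)"
    using C by (intro landau_o.smallD[OF assms(6)]) auto
  moreover note assms(7)[OF \<epsilon>(1)]
  ultimately show "\<forall>\<^sub>F n in at_top. cmod (\<Sum>g\<in>polys_below (int n). \<nu> g * f g)
      \<le> \<delta> * norm (of_nat CARD('a) ^ n :: complex)"
  proof eventually_elim
    case (elim n)
    define X where "X = nat \<lceil>\<phi> n\<rceil>"
    define I where "I = 16 ^ J * X"
    have XI: "X + 2 * I = C * X" by (simp add: I_def C_def algebra_simps)
    have \<phi>: "2 * real C \<le> \<phi> n" "6 / \<delta> \<le> \<phi> n" "\<phi> n * (4 * real C) \<le> real n"
      using elim(1,2) assms(4)[of n] C by (auto simp: field_simps)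
    then have "\<phi> n \<ge> 2" using C by linarith
    have X: "\<phi> n \<le> real X" "real X \<le> \<phi> n + 1" unfolding X_def using assms(4)[of n] by linarith+
    then have "X > 0" using \<open>\<phi> n \<ge> 2\<close> by linarith
    have "real C * real X \<le> real C * (2 * \<phi> n)"
      using X \<open>\<phi> n \<ge> 2\<close> C by (intro mult_left_mono) linarith+
    also have "\<dots> = 2 * real C * \<phi> n" by simp
    finally have CX: "real C * real X \<le> 2 * real C * \<phi> n" .
    with \<phi>(3) have "2 * (real C * real X) \<le> real n" by (simp add: algebra_simps)
    then have n: "2 * (X + 2 * I) \<le> n" unfolding XI by (simp flip: of_nat_mult)
    have "2 * real C * \<phi> n \<le> (\<phi> n)\<^sup>2"
      unfolding power2_eq_square using \<phi>(1) \<open>\<phi> n \<ge> 2\<close> by (intro mult_right_mono) auto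
    with CX have "real (X + 2 * I) \<le> \<phi> n + (\<phi> n)\<^sup>2"
      unfolding XI using \<open>\<phi> n \<ge> 2\<close> by simp
    then have window: "\<phi> n \<le> real (X + 2 * i) \<and> real (X + 2 * i) \<le> \<phi> n + (\<phi> n)\<^sup>2" if "i < I" for i
      using that X by auto
    define L where "L = (\<Sum>p :: 'a poly | irreducible p \<and> X \<le> degree p \<and> degree p < X + 2 * I. 1 / pnorm p)"
    define S where "S = (\<Sum>g\<in>polys_below (int n). \<nu> g * f g)"
    have bound: "L * cmod S \<le> q ^ n * (sqrt ((q - 1) * L) + 2 * L / 2 ^ X + sqrt \<epsilon> * q * L)"
      unfolding L_def S_def q_def
    proof (rule katai_bound[OF assms(1-3) less_imp_le[OF \<epsilon>(1)] n])
      show "correlation_sum f n (X + 2 * i)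
          \<le> \<epsilon> * ((real (card (irreds (X + 2 * i) :: 'a poly set)))\<^sup>2
                  * real CARD('a) powi (int n - int (X + 2 * i)))" if "i < I" for i
        using elim(3) window[OF that] by blast
    qed
    have "real J * (q - 1) / 8
        \<le> (\<Sum>p :: 'a poly | irreducible p \<and> X < degree p \<and> degree p \<le> 16 ^ J * X. 1 / pnorm p)"
      unfolding q_def by (rule sum_inverse_pnorm_ge[OF \<open>X > 0\<close>])
    \<comment> \<open>As \<open>I = 16 ^ J * X\<close> and \<open>X > 0\<close>, the range ending
      before \<open>X + 2 * I\<close> contains all degrees up to \<open>16 ^ J * X\<close>.\<close>
    also have "\<dots> \<le> L"
      unfolding L_def
    proof (rule sum_mono2)
      show "finite {p :: 'a poly. irreducible p \<and> X \<le> degree p \<and> degree p < X + 2 * I}"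
        by (rule finite_subset[OF _ finite_irreducible_degree_le[of "X + 2 * I"]]) auto
    qed (use \<open>X > 0\<close> in \<open>auto simp: I_def less_imp_le\<close>)
    finally have "real J * (q - 1) / 8 \<le> L" .
    moreover have "72 / \<delta>\<^sup>2 * (q - 1) / 8 \<le> real J * (q - 1) / 8"
      using J q2 by (intro divide_right_mono mult_right_mono) auto
    ultimately have "72 / \<delta>\<^sup>2 * (q - 1) / 8 \<le> L" by linarith
    then have "9 * (q - 1) \<le> \<delta>\<^sup>2 * L" using \<open>\<delta> > 0\<close> by (simp add: field_simps)
    moreover have "0 < 9 * (q - 1)" using q2 by simp
    ultimately have "0 < \<delta>\<^sup>2 * L" by linarith
    then have "L > 0" using \<open>\<delta> > 0\<close> by (simp add: zero_less_mult_iff)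
    have "9 * (q - 1) * L \<le> \<delta>\<^sup>2 * L * L"
      using \<open>9 * (q - 1) \<le> \<delta>\<^sup>2 * L\<close> \<open>L > 0\<close> by (intro mult_right_mono) auto
    then have "(q - 1) * L \<le> (\<delta> / 3 * L)\<^sup>2" by (simp add: power2_eq_square algebra_simps)
    then have 1: "sqrt ((q - 1) * L) \<le> \<delta> / 3 * L"
      using \<open>\<delta> > 0\<close> \<open>L > 0\<close> by (intro real_le_lsqrt) auto
    have "6 / \<delta> \<le> 2 ^ X"
    proof -
      have "real X \<le> 2 ^ X" using less_exp[of X] by (metis less_imp_le of_nat_le_iff of_nat_numeral of_nat_power)
      with X \<phi> show ?thesis by linarith
    qed
    then have "2 / 2 ^ X \<le> \<delta> / 3" using \<open>\<delta> > 0\<close> by (simp add: field_simps)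
    then have 2: "2 * L / 2 ^ X \<le> \<delta> / 3 * L"
      using mult_right_mono[of "2 / 2 ^ X" "\<delta> / 3" L] \<open>L > 0\<close> by simp
    have "sqrt ((q - 1) * L) + 2 * L / 2 ^ X + sqrt \<epsilon> * q * L \<le> \<delta> * L"
      using add_mono[OF 1 2] unfolding \<epsilon>(2) by linarith
    then have "q ^ n * (sqrt ((q - 1) * L) + 2 * L / 2 ^ X + sqrt \<epsilon> * q * L) \<le> q ^ n * (\<delta> * L)"
      using q2 by (intro mult_left_mono) auto
    with bound have "L * cmod S \<le> L * (\<delta> * q ^ n)" by (simp add: mult_ac)
    then have "cmod S \<le> \<delta> * q ^ n" using \<open>L > 0\<close> by simp
    then show ?case by (simp add: S_def q_def norm_power)
  qed
qed

end
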